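(* Let $m\ge 1$ be an integer, $\nu\in(0,1]$, $\underline{\lambda}=(\lambda_1,\ldots,\lambda_m)\in(0,\infty)^m$ with $s(\underline{\lambda})\ge 1$, let $\{\underline{M}^\nu(t):t\ge 0\}$ be the multivariate alternative fractional Poisson process with parameters $\nu$ and $\underline{\lambda}$, and let $$\hat{\mathcal{V}}_t:=g_{s(\underline{\lambda})}\left(\frac{s(\underline{M}^\nu(t))}{t}\right),\qquad t>0,$$ where $g_{s(\underline{\lambda})}$ is the inverse of the function $f_{s(\underline{\lambda})}(x)=\frac{1}{x}(s(\underline{\lambda}))^{1/x}$ (extended to $[0,\infty]$). Then the family of random variables $\{\hat{\mathcal{V}}_t:t>0\}$ satisfies, as $t\to\infty$, the large deviation principle with speed $t$ and good rate function $J_\nu$ defined by $$J_\nu(\hat{\nu}):=\begin{cases} \frac{\nu}{\hat{\nu}}(s(\underline{\lambda}))^{1/\hat{\nu}}\log\left(\frac{\nu}{\hat{\nu}}(s(\underline{\lambda}))^{1/\hat{\nu}-1/\nu}\right)-\frac{\nu}{\hat{\nu}}(s(\underline{\lambda}))^{1/\hat{\nu}}+(s(\underline{\lambda}))^{1/\nu} & \text{if } \hat{\nu}\ge 0,\\ \infty & \text{if } \hat{\nu}<0, \end{cases}$$ where the values at the endpoints are understood as limits: $J_\nu(0)=\infty$ and $J_\nu(\infty)=(s(\underline{\lambda}))^{1/\nu}$. Here $\hat{\mathcal{V}}_t$ is regarded as a random variable with values in $(-\infty,\infty]$ with its usual (order) topology; it takes values in $[0,\infty]$.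
   Context: Notation: for $\underline{x}\in\mathbb{R}^m$, $s(\underline{x})=\sum_{i=1}^m x_i$. Convention $0\log 0=0$. Mittag-Leffler function: $E_{\alpha,\beta}(x):=\sum_{r\ge 0}\frac{x^r}{\Gamma(\alpha r+\beta)}$. Multivariate alternative fractional Poisson process with parameters $\nu$ and $\underline{\lambda}$: a process $\underline{M}^\nu(t)=(M_1^\nu(t),\ldots,M_m^\nu(t))$, $t\ge 0$, with values in $\{0,1,2,\ldots\}^m$, whose one-dimensional (fixed $t$) distributions are $$P(\underline{M}^\nu(t)=\underline{k})=\frac{(s(\underline{k}))!}{k_1!\cdots k_m!}\prod_{i=1}^m\lambda_i^{k_i}\cdot\frac{(t^\nu)^{s(\underline{k})}}{\Gamma(\nu s(\underline{k})+1)}\cdot\frac{1}{E_{\nu,1}(s(\underline{\lambda})t^\nu)}\quad\text{for all integers } k_1,\ldots,k_m\ge 0.$$ Equivalently, given the sum $s(\underline{M}^\nu(t))$, the vector is multinomial with probabilities $\lambda_i/s(\underline{\lambda})$, and $P(s(\underline{M}^\nu(t))=h)=\frac{(s(\underline{\lambda})t^\nu)^h}{\Gamma(\nu h+1)E_{\nu,1}(s(\underline{\lambda})t^\nu)}$ for integers $h\ge0$. Only these fixed-time distributions are relevant. The functions $f_a$ and $g_a$: for $a\ge 1$, $f_a:(0,\infty)\to(0,\infty)$, $f_a(x):=\frac{1}{x}a^{1/x}$, is a strictly decreasing continuous bijection with inverse $g_a$. Both are extended to continuous maps $[0,\infty]\to[0,\infty]$ (with the usual topology of the extended half-line) by $f_a(0)=g_a(0)=\infty$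 and $f_a(\infty)=g_a(\infty)=0$. Large deviation principle: let $\mathcal{Z}$ be a Hausdorff topological space with its Borel $\sigma$-algebra. A rate function is a lower semi-continuous $I:\mathcal{Z}\to[0,\infty]$; it is good if all level sets $\{z\in\mathcal{Z}:I(z)\le\gamma\}$, $\gamma\ge 0$, are compact. If $v_t\to\infty$ as $t\to\infty$, a family of $\mathcal{Z}$-valued random variables $\{Z_t:t>0\}$ satisfies the large deviation principle (as $t\to\infty$) with speed $v_t$ and rate function $I$ if $\limsup_{t\to\infty}\frac{1}{v_t}\log P(Z_t\in F)\le-\inf_{z\in F}I(z)$ for all closed $F$ and $\liminf_{t\to\infty}\frac{1}{v_t}\log P(Z_t\in G)\ge-\inf_{z\in G}I(z)$ for all open $G$. *)

theory Defs
  imports "HOL-Probability.Probability"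
begin

definition coord_sum :: "('a::comm_monoid_add) ^ 'm \<Rightarrow> 'a"
  where "coord_sum x = (\<Sum>i\<in>UNIV. x $ i)"

definition mittag_leffler :: "real \<Rightarrow> real \<Rightarrow> real \<Rightarrow> real"
  where "mittag_leffler \<alpha> \<beta> x = (\<Sum>r. x ^ r / Gamma (\<alpha> * real r + \<beta>))"

text \<open>Only the one-dimensional distributions of the process are prescribed; its joint laws at
  several times are left arbitrary. The dimension is the cardinality of the index type \<open>'m\<close>.\<close>

definition alt_frac_poisson ::
    "'w measure \<Rightarrow> real \<Rightarrow> real ^ 'm \<Rightarrow> (real \<Rightarrow> 'w \<Rightarrow> nat ^ 'm) \<Rightarrow> bool"
  where "alt_frac_poisson P \<nu> lam M \<longleftrightarrow>
    (\<forall>t\<ge>0. M t \<in> measurable P (count_space UNIV) \<and>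
      (\<forall>k. measure P {w \<in> space P. M t w = k} =
        fact (coord_sum k) / (\<Prod>i\<in>UNIV. fact (k $ i)) * (\<Prod>i\<in>UNIV. (lam $ i) ^ (k $ i))
        * ((t powr \<nu>) ^ coord_sum k / Gamma (\<nu> * real (coord_sum k) + 1))
        * (1 / mittag_leffler \<nu> 1 (coord_sum lam * t powr \<nu>))))"

definition f_fun :: "real \<Rightarrow> real \<Rightarrow> real"
  where "f_fun a x = 1 / x * a powr (1 / x)"

text \<open>The inverse of \<open>f_fun a\<close> on the positive half-line, extended to \<open>[0,\<infinity>]\<close>.
  The values at negative arguments are irrelevant.\<close>

definition g_fun :: "real \<Rightarrow> ereal \<Rightarrow> ereal"
  where "g_fun a y =
    (if y \<le> 0 then \<infinity> else if y = \<infinity> then 0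
     else ereal (the_inv_into {0<..} (f_fun a) (real_of_ereal y)))"

lemma f_fun_bij_betw:
  assumes "1 \<le> a"
  shows "bij_betw (f_fun a) {0<..} {0<..}"
proof -
  have anti: "f_fun a y < f_fun a x" if "0 < x" "x < y" for x y
  proof -
    have "1 / y < 1 / x"
      using that by (simp add: frac_less2)
    moreover have "a powr (1 / y) \<le> a powr (1 / x)"
      using calculation assms by (intro powr_mono) auto
    ultimately show ?thesis
      unfolding f_fun_def using that assms by (intro mult_less_le_imp_less) auto
  qed
  have inj: "inj_on (f_fun a) {0<..}"
    by (rule inj_onI) (metis anti greaterThan_iff less_irrefl linorder_neqE_linordered_idom)
  have "\<exists>x>0. f_fun a x = y" if "0 < y" for y
  proof -
    define l where "l = min 1 (1 / y)"
    define u where "u = max 1 (a / y)"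
    have l: "0 < l" "l \<le> 1" "l \<le> 1 / y" and u: "1 \<le> u" "a / y \<le> u"
      using that by (auto simp: l_def u_def)
    have "y \<le> 1 / l"
      using l that by (simp add: field_simps)
    moreover have "1 \<le> a powr (1 / l)"
      using assms l by (intro ge_one_powr_ge_zero) auto
    ultimately have "y * 1 \<le> 1 / l * a powr (1 / l)"
      using that l by (intro mult_mono) auto
    then have fl: "y \<le> f_fun a l"
      by (simp add: f_fun_def)
    have "a powr (1 / u) \<le> a powr 1"
      using assms u by (intro powr_mono) auto
    then have "1 / u * a powr (1 / u) \<le> 1 / u * a"
      using assms u by (intro mult_left_mono) auto
    also have "\<dots> \<le> y"
      using u that by (simp add: field_simps)
    finally have fu: "f_fun a u \<le> y"
      by (simp add: f_fun_def)
    have "continuous_on {l..u} (f_fun a)"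
      unfolding f_fun_def using l assms by (intro continuous_intros) auto
    moreover have "l \<le> u"
      using l u by linarith
    ultimately obtain x where "l \<le> x" "f_fun a x = y"
      using IVT2'[of "f_fun a" u y l] fl fu by blast
    then show ?thesis
      using l by (intro exI[of _ x]) auto
  qed
  moreover have "0 < f_fun a x" if "0 < x" for x
    using that assms by (simp add: f_fun_def)
  ultimately have "f_fun a ` {0<..} = {0<..}"
    by (force simp: image_iff)
  with inj show ?thesis
    by (simp add: bij_betw_def)
qed

text \<open>Logarithm on \<open>[0,\<infinity>)\<close> with \<open>log 0 = -\<infinity>\<close>, needed since \<open>ln 0 = 0\<close> over the reals.\<close>

definition elog :: "real \<Rightarrow> ereal"
  where "elog p = (if p \<le> 0 then - \<infinity> else ereal (ln p))"

definition rate_function :: "'z topology \<Rightarrow> ('z \<Rightarrow> ereal) \<Rightarrow> bool"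
  where "rate_function Z I \<longleftrightarrow>
    (\<forall>z\<in>topspace Z. 0 \<le> I z) \<and> (\<forall>c. openin Z {z \<in> topspace Z. c < I z})"

definition good_rate_function :: "'z topology \<Rightarrow> ('z \<Rightarrow> ereal) \<Rightarrow> bool"
  where "good_rate_function Z I \<longleftrightarrow>
    rate_function Z I \<and> (\<forall>\<gamma>::real. 0 \<le> \<gamma> \<longrightarrow> compactin Z {z \<in> topspace Z. I z \<le> ereal \<gamma>})"

definition borel_measure_of :: "'z topology \<Rightarrow> 'z measure"
  where "borel_measure_of Z = sigma (topspace Z) {U. openin Z U}"

definition satisfies_LDP ::
    "'w measure \<Rightarrow> 'z topology \<Rightarrow> (real \<Rightarrow> 'w \<Rightarrow> 'z) \<Rightarrow> (real \<Rightarrow> real) \<Rightarrow> ('z \<Rightarrow> ereal) \<Rightarrow> bool"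
  where "satisfies_LDP P Z X v I \<longleftrightarrow>
    prob_space P \<and> Hausdorff_space Z \<and> rate_function Z I \<and>
    filterlim v at_top at_top \<and>
    (\<forall>t>0. X t \<in> measurable P (borel_measure_of Z)) \<and>
    (\<forall>F. closedin Z F \<longrightarrow>
      Limsup at_top (\<lambda>t. ereal (1 / v t) * elog (measure P {w \<in> space P. X t w \<in> F}))
        \<le> - (INF z\<in>F. I z)) \<and>
    (\<forall>G. openin Z G \<longrightarrow>
      - (INF z\<in>G. I z) \<le>
      Liminf at_top (\<lambda>t. ereal (1 / v t) * elog (measure P {w \<in> space P. X t w \<in> G})))"

text \<open>The values at \<open>0\<close> and \<open>\<infinity>\<close> are the limits of the formula on \<open>(0,\<infinity>)\<close>.\<close>

definition J_rate :: "real \<Rightarrow> real \<Rightarrow> ereal \<Rightarrow> ereal"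
  where "J_rate \<nu> s x =
    (if x \<le> 0 then \<infinity>
     else if x = \<infinity> then ereal (s powr (1 / \<nu>))
     else let r = real_of_ereal x in
       ereal (\<nu> / r * s powr (1 / r) * ln (\<nu> / r * s powr (1 / r - 1 / \<nu>))
              - \<nu> / r * s powr (1 / r) + s powr (1 / \<nu>)))"

end

theory Submission
  imports Defs "HOL-Real_Asymp.Real_Asymp"
begin

text \<open>Let \<open>s = s(\<lambda>)\<close> and \<open>c = s powr (1 / \<nu>)\<close>. By the multinomial theorem the coordinate sum of \<open>M(t)\<close>
  takes the value \<open>h\<close> with probability \<open>(c t) powr (\<nu> h) / Gamma (\<nu> h + 1)\<close>, divided by the sum of
  these terms over all \<open>h\<close>: a Poisson law of mean \<open>c t\<close>, sampled on the lattice \<open>\<nu> \<nat>\<close> instead of \<open>\<nat>\<close> and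
  renormalised. Stirling's formula in the elementary form
  \<open>exp (z ln z - z) \<le> Gamma (z + 1) \<le> e (z + 1) exp (z ln z - z)\<close> shows that the term at \<open>h\<close> is
  \<open>exp (c t - t H (h / t))\<close> up to a factor linear in \<open>h\<close>, where \<open>H y = poisson_rate c (\<nu> y)\<close> and
  \<open>poisson_rate c p = p ln (p / c) - p + c\<close>. The formula defining \<open>J_rate\<close> is nothing but this rate
  at \<open>y = f\<^sub>s(x)\<close>, so \<open>J_rate (g\<^sub>s(y)) = H y\<close>, endpoints included.

  The large deviation bounds are therefore proved at the level of point masses.
  For the upper bound, any set of \<open>h\<close> on which \<open>H (h / t) \<ge> L\<close> has terms summing to at most
  \<open>exp (c t - t L)\<close> times a factor of order \<open>t\<close>; the tail is controlled by giving
  away one unit out of the exponent \<open>t H\<close> and bounding it by a tangent line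
  (\<open>sum_ml_term_le\<close>). The normalising sum is at least
  \<open>exp (c t)\<close> divided by a factor of order \<open>t\<close>, by a term close to the largest one (\<open>sum_ml_term_ge\<close>).
  For the lower bound, a point \<open>x > 0\<close> of an open set is \<open>g\<^sub>s(y)\<close> with \<open>y = f\<^sub>s(x)\<close>, where \<open>y = 0\<close> if
  \<open>x = \<infinity>\<close>; the numbers \<open>h = \<lfloor>y t\<rfloor>\<close> satisfy
  \<open>h / t \<rightarrow> y\<close>, so \<open>g\<^sub>s(h / t)\<close> ends up in the open set by continuity, and the single atom at \<open>h\<close>
  has probability \<open>exp (- t H (h / t))\<close> up to polynomial factors. Points \<open>x \<le> 0\<close> have infinite rate.

  The rate function is good because it is continuous on the compact extended line and infinite
  at \<open>- \<infinity>\<close> (\<open>continuous_J_rate\<close>).\<close>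

section \<open>Elementary Stirling bounds\<close>

text \<open>Euler's integral for \<open>Gamma (z + 1)\<close> restricted to \<open>[u, \<infinity>)\<close>, where \<open>x powr z\<close> is at least
  \<open>u powr z\<close>. The choice \<open>u = z\<close> gives the lower Stirling bound.\<close>
lemma Gamma_ge_powr_mult_exp:
  fixes z u :: real
  assumes "0 \<le> z" "0 < u"
  shows "u powr z * exp (- u) \<le> Gamma (z + 1)"
proof -
  have "((\<lambda>x. exp (- 1 * x)) has_integral exp (- 1 * u) / 1) {u..}"
    by (rule has_integral_exp_minus_to_infinity) simp
  then have "((\<lambda>x. u powr z * exp (- x)) has_integral (u powr z * exp (- u))) {u..}"
    using has_integral_mult_right[of "\<lambda>x. exp (- x)" "exp (- u)"] by simp
  then have tail: "((\<lambda>x. if x \<in> {u..} then u powr z * exp (- x) else 0)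
      has_integral (u powr z * exp (- u))) {0..}"
    using assms by (subst has_integral_restrict) auto
  have whole: "((\<lambda>x. x powr z / exp x) has_integral Gamma (z + 1)) {0..}"
    using Gamma_integral_real[of "z + 1"] assms by simp
  show ?thesis
    using tail whole
  proof (rule has_integral_le)
    show "(if x \<in> {u..} then u powr z * exp (- x) else 0) \<le> x powr z / exp x" for x
      using assms by (auto simp: exp_minus divide_inverse intro!: mult_right_mono powr_mono2)
  qed
qed

text \<open>In Euler's integral the integrand \<open>x powr z * exp (- x)\<close> is split as
  \<open>x powr z * exp (- x * z / (z + 1))\<close> times \<open>exp (- x / (z + 1))\<close>: the first factor is maximal at
  \<open>x = z + 1\<close>, and the second has integral \<open>z + 1\<close>. Both Stirling bounds are written with
  \<open>exp (z * ln z - z)\<close>, which has the right value at \<open>z = 0\<close>, unlike \<open>z powr z\<close>.\<close>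
lemma Gamma_plus1_upper:
  fixes z :: real
  assumes "0 \<le> z"
  shows "Gamma (z + 1) \<le> (z + 1) * exp 1 * exp (z * ln z - z)"
proof -
  have "((\<lambda>x. exp (- (1 / (z + 1)) * x)) has_integral
      exp (- (1 / (z + 1)) * 0) / (1 / (z + 1))) {0..}"
    by (rule has_integral_exp_minus_to_infinity) (use assms in simp)
  then have "((\<lambda>x. exp (- (x / (z + 1)))) has_integral (z + 1)) {0..}"
    by simp
  then have dom: "((\<lambda>x. exp (z * ln (z + 1) - z) * exp (- (x / (z + 1))))
      has_integral (exp (z * ln (z + 1) - z) * (z + 1))) {0..}"
    by (rule has_integral_mult_right)
  have whole: "((\<lambda>x. x powr z / exp x) has_integral Gamma (z + 1)) {0..}"
    using Gamma_integral_real[of "z + 1"] assms by simp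
  have "Gamma (z + 1) \<le> exp (z * ln (z + 1) - z) * (z + 1)"
    using whole dom
  proof (rule has_integral_le)
    fix x :: real
    assume "x \<in> {0..}"
    then consider "x = 0" | "0 < x"
      by force
    then show "x powr z / exp x \<le> exp (z * ln (z + 1) - z) * exp (- (x / (z + 1)))"
    proof cases
      case 2
      have "ln (x / (z + 1)) \<le> x / (z + 1) - 1"
        using 2 assms by (intro ln_le_minus_one) auto
      then have "z * (ln x - ln (z + 1)) \<le> z * (x / (z + 1) - 1)"
        using 2 assms by (intro mult_left_mono) (auto simp: ln_div)
      moreover have "z * (x / (z + 1)) = x - x / (z + 1)"
        using assms by (simp add: field_simps)
      ultimately have "z * ln x - x \<le> z * ln (z + 1) - z + - (x / (z + 1))"
        by (simp add: algebra_simps)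
      then have "exp (z * ln x - x) \<le> exp (z * ln (z + 1) - z + - (x / (z + 1)))"
        by simp
      moreover have "x powr z / exp x = exp (z * ln x - x)"
        using 2 by (simp add: powr_def exp_diff)
      ultimately show ?thesis
        by (simp only: exp_add)
    qed simp
  qed
  also have "\<dots> \<le> exp (1 + (z * ln z - z)) * (z + 1)"
  proof -
    have "z * ln (z + 1) \<le> 1 + z * ln z"
    proof (cases "z = 0")
      case False
      then have z: "0 < z"
        using assms by simp
      have "ln ((z + 1) / z) \<le> (z + 1) / z - 1"
        using z by (intro ln_le_minus_one) auto
      then have "z * (ln (z + 1) - ln z) \<le> z * ((z + 1) / z - 1)"
        using z by (intro mult_left_mono) (auto simp: ln_div)
      also have "z * ((z + 1) / z - 1) = 1"
        using z by (simp add: field_simps)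
      finally show ?thesis
        by (simp add: algebra_simps)
    qed simp
    then show ?thesis
      using assms by (intro mult_right_mono) auto
  qed
  finally show ?thesis
    by (simp add: exp_add mult_ac)
qed

section \<open>The Poisson rate function\<close>

text \<open>The relative entropy of the Poisson law with mean \<open>p\<close> with respect to the one with mean \<open>c\<close>.
  At \<open>p = 0\<close> the product vanishes, as the convention \<open>0 log 0 = 0\<close> demands.\<close>
definition poisson_rate :: "real \<Rightarrow> real \<Rightarrow> real"
  where "poisson_rate c p = p * ln (p / c) - p + c"

lemma poisson_rate_nonneg:
  assumes "0 < c" "0 \<le> p"
  shows "0 \<le> poisson_rate c p"
proof (cases "p = 0")
  case False
  then have p: "0 < p"
    using assms by simp
  have "ln (c / p) \<le> c / p - 1"
    using p assms by (intro ln_le_minus_one) auto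
  then have "p * ln (c / p) \<le> p * (c / p - 1)"
    using p by (intro mult_left_mono) auto
  then show ?thesis
    using p assms by (simp add: poisson_rate_def ln_div algebra_simps)
qed (use assms in \<open>simp add: poisson_rate_def\<close>)

lemma poisson_rate_change_rate:
  assumes "0 < c" "0 < q" "0 \<le> p"
  shows "poisson_rate c p = poisson_rate q p + p * ln (q / c) + c - q"
  using assms by (cases "p = 0") (auto simp: poisson_rate_def ln_div algebra_simps)

text \<open>The tangent at \<open>p = exp 1 * c\<close>, where the slope is 1. It supplies the geometric factor that
  makes sums of \<open>exp (- poisson_rate c _)\<close> over the lattice converge.\<close>
lemma poisson_rate_ge_linear:
  assumes "0 < c" "0 \<le> p"
  shows "p - (exp 1 - 1) * c \<le> poisson_rate c p"
  using poisson_rate_change_rate[of c "exp 1 * c" p] poisson_rate_nonneg[of "exp 1 * c" p] assms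
  by (simp add: algebra_simps)

lemma poisson_rate_scale:
  assumes "0 < c" "0 < t"
  shows "poisson_rate (c * t) (p * t) = t * poisson_rate c p"
  using assms by (simp add: poisson_rate_def algebra_simps)

text \<open>With the Stirling bounds, this turns \<open>u powr z / Gamma (z + 1)\<close> into
  \<open>exp (u - poisson_rate u z)\<close>, up to a factor that is linear in \<open>z\<close>.\<close>
lemma powr_eq_exp_poisson_rate:
  assumes "0 < u" "0 \<le> z"
  shows "u powr z = exp (u - poisson_rate u z) * exp (z * ln z - z)"
proof (cases "z = 0")
  case True then show ?thesis using assms by (simp add: poisson_rate_def)
next
  case False
  then show ?thesis
    using assms by (simp add: poisson_rate_def powr_def ln_div algebra_simps flip: exp_add)
qed

lemma powr_div_Gamma_le:
  assumes "0 < u" "0 \<le> z"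
  shows "u powr z / Gamma (z + 1) \<le> exp (u - poisson_rate u z)"
proof -
  have "exp (z * ln z - z) \<le> Gamma (z + 1)"
  proof (cases "z = 0")
    case False
    then show ?thesis
      using Gamma_ge_powr_mult_exp[of z z] assms by (simp add: powr_def exp_minus exp_diff divide_inverse)
  qed simp
  moreover have "0 < Gamma (z + 1)"
    using assms by (intro Gamma_real_pos) auto
  ultimately show ?thesis
    using assms by (simp add: powr_eq_exp_poisson_rate divide_le_eq)
qed

lemma powr_div_Gamma_ge:
  assumes "0 < u" "0 \<le> z"
  shows "exp (u - poisson_rate u z) / (exp 1 * (z + 1)) \<le> u powr z / Gamma (z + 1)"
proof -
  define B where "B = exp (z * ln z - z)"
  have "0 < Gamma (z + 1)"
    using assms by (intro Gamma_real_pos) auto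
  then have "B / ((z + 1) * exp 1 * B) \<le> B / Gamma (z + 1)"
    using Gamma_plus1_upper[OF assms(2)] assms by (intro divide_left_mono) (auto simp: B_def)
  then have "1 / (exp 1 * (z + 1)) \<le> B / Gamma (z + 1)"
    by (simp add: B_def mult.commute)
  then have "exp (u - poisson_rate u z) * (1 / (exp 1 * (z + 1))) \<le> exp (u - poisson_rate u z) * (B / Gamma (z + 1))"
    by (rule mult_left_mono) simp
  then show ?thesis
    using assms by (simp add: powr_eq_exp_poisson_rate B_def)
qed

section \<open>The law of the coordinate sum\<close>

text \<open>The multinomial theorem divided by \<open>fact h\<close>, read off as the coefficient of order \<open>h\<close> in
  \<open>exp (x\<^sub>1 X) * \<dots> * exp (x\<^sub>m X) = exp ((x\<^sub>1 + \<dots> + x\<^sub>m) X)\<close>. Vectors of naturals indexed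
  by a finite type correspond to multisets over that type.\<close>
lemma sum_multinomial_exp:
  fixes x :: "real ^ 'm"
  shows "(\<Sum>k | coord_sum k = h. \<Prod>i\<in>UNIV. (x $ i) ^ (k $ i) / fact (k $ i)) = coord_sum x ^ h / fact h"
    and "finite {k :: nat ^ 'm. coord_sum k = h}"
proof -
  define A where "A = multisets_of_size (UNIV :: 'm set) h"
  have size: "size X = (\<Sum>i\<in>UNIV. count X i)" for X :: "'m multiset"
    unfolding size_multiset_overloaded_eq by (rule sum.mono_neutral_left) (auto simp: not_in_iff)
  have bij: "bij_betw (\<lambda>X. \<chi> i. count X i) A {k :: nat ^ 'm. coord_sum k = h}"
    by (rule bij_betwI[where g = "\<lambda>k. Abs_multiset (\<lambda>i. k $ i)"])
       (auto simp: A_def multisets_of_size_def size coord_sum_def vec_eq_iff)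
  have "finite A"
    unfolding A_def by (rule finite_multisets_of_size) simp
  then show "finite {k :: nat ^ 'm. coord_sum k = h}"
    using bij by (simp add: bij_betw_finite)
  have "(\<Prod>i\<in>S. fps_exp (x $ i)) = fps_exp (\<Sum>i\<in>S. x $ i)" if "finite S" for S
    using that by (induction S) (auto simp: fps_exp_add_mult)
  then have "coord_sum x ^ h / fact h = fps_nth (\<Prod>i\<in>UNIV. fps_exp (x $ i)) h"
    by (simp add: coord_sum_def)
  also have "\<dots> = (\<Sum>X\<in>A. \<Prod>i\<in>UNIV. (x $ i) ^ count X i / fact (count X i))"
    by (simp add: fps_prod_nth' A_def)
  also have "\<dots> = (\<Sum>k | coord_sum k = h. \<Prod>i\<in>UNIV. (x $ i) ^ (k $ i) / fact (k $ i))"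
    using sum.reindex_bij_betw[OF bij, of "\<lambda>k. \<Prod>i\<in>UNIV. (x $ i) ^ (k $ i) / fact (k $ i)"] by simp
  finally show "(\<Sum>k | coord_sum k = h. \<Prod>i\<in>UNIV. (x $ i) ^ (k $ i) / fact (k $ i)) = coord_sum x ^ h / fact h" ..
qed

text \<open>The terms of the series of \<open>E\<^bsub>\<nu>,1\<^esub>((c t)\<^sup>\<nu>)\<close>. With \<open>c = s(\<lambda>) powr (1 / \<nu>)\<close>, the argument
  \<open>(c t)\<^sup>\<nu>\<close> is \<open>s(\<lambda>) t\<^sup>\<nu>\<close>, so that these are the unnormalised point masses of the coordinate sum.\<close>
definition ml_term :: "real \<Rightarrow> real \<Rightarrow> real \<Rightarrow> nat \<Rightarrow> real"
  where "ml_term c \<nu> t h = (c * t) powr (\<nu> * real h) / Gamma (\<nu> * real h + 1)"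

lemma ml_term_nonneg:
  assumes "0 < \<nu>"
  shows "0 \<le> ml_term c \<nu> t h"
  using assms unfolding ml_term_def by (intro divide_nonneg_nonneg less_imp_le[OF Gamma_real_pos]) (auto intro: add_nonneg_pos)

lemma prob_coord_sum:
  fixes lam :: "real ^ 'm"
  assumes "prob_space P" "0 < \<nu>" "0 < coord_sum lam" "alt_frac_poisson P \<nu> lam M" "0 < t"
  shows "measure P {w \<in> space P. coord_sum (M t w) = h} =
    ml_term (coord_sum lam powr (1 / \<nu>)) \<nu> t h / mittag_leffler \<nu> 1 (coord_sum lam * t powr \<nu>)"
proof -
  interpret prob_space P by fact
  define s where "s = coord_sum lam"
  define E where "E = mittag_leffler \<nu> 1 (s * t powr \<nu>)"
  define K where "K = {k :: nat ^ 'm. coord_sum k = h}"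
  define C where "C = fact h * ((t powr \<nu>) ^ h / Gamma (\<nu> * real h + 1)) / E"
  have fin: "finite K"
    unfolding K_def by (rule sum_multinomial_exp)
  have meas: "M t \<in> measurable P (count_space UNIV)"
    and law: "prob {w \<in> space P. M t w = k} =
      fact (coord_sum k) / (\<Prod>i\<in>UNIV. fact (k $ i)) * (\<Prod>i\<in>UNIV. (lam $ i) ^ (k $ i))
        * ((t powr \<nu>) ^ coord_sum k / Gamma (\<nu> * real (coord_sum k) + 1)) * (1 / E)" for k
    using assms unfolding alt_frac_poisson_def E_def s_def by auto
  have "{w \<in> space P. coord_sum (M t w) = h} = (\<Union>k\<in>K. {w \<in> space P. M t w = k})"
    by (auto simp: K_def)
  also have "prob \<dots> = (\<Sum>k\<in>K. prob {w \<in> space P. M t w = k})"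
    using fin meas by (intro finite_measure_finite_Union) (auto simp: disjoint_family_on_def)
  also have "\<dots> = (\<Sum>k\<in>K. C * (\<Prod>i\<in>UNIV. (lam $ i) ^ (k $ i) / fact (k $ i)))"
    by (intro sum.cong) (auto simp: law K_def C_def prod_dividef mult_ac)
  also have "\<dots> = C * (s ^ h / fact h)"
    unfolding sum_distrib_left[symmetric] K_def s_def by (simp only: sum_multinomial_exp)
  also have "\<dots> = (s * t powr \<nu>) ^ h / Gamma (\<nu> * real h + 1) / E"
    by (simp add: C_def power_mult_distrib)
  also have "(s * t powr \<nu>) ^ h = (s powr (1 / \<nu>) * t) powr (\<nu> * real h)"
  proof -
    have "s * t powr \<nu> = (s powr (1 / \<nu>) * t) powr \<nu>"
      using assms by (simp add: powr_mult powr_powr s_def)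
    moreover have "0 < s powr (1 / \<nu>) * t"
      using assms by (simp add: s_def)
    ultimately show ?thesis
      using powr_realpow[of "(s powr (1 / \<nu>) * t) powr \<nu>" h] by (simp only: powr_powr powr_gt_zero)
  qed
  finally show ?thesis
    by (simp add: ml_term_def s_def E_def)
qed

lemma prob_coord_sum_in:
  fixes lam :: "real ^ 'm"
  assumes "prob_space P" "0 < \<nu>" "0 < coord_sum lam" "alt_frac_poisson P \<nu> lam M" "0 < t"
  shows "(\<lambda>h. if h \<in> S then ml_term (coord_sum lam powr (1 / \<nu>)) \<nu> t h
      / mittag_leffler \<nu> 1 (coord_sum lam * t powr \<nu>) else 0)
    sums measure P {w \<in> space P. coord_sum (M t w) \<in> S}"
proof -
  interpret prob_space P by fact
  define A where "A h = {w \<in> space P. coord_sum (M t w) = h \<and> h \<in> S}" for h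
  have "M t \<in> measurable P (count_space UNIV)"
    using assms unfolding alt_frac_poisson_def by auto
  then have "M t -` {k. coord_sum k = h \<and> h \<in> S} \<inter> space P \<in> events" for h
    by (rule measurable_sets) simp
  moreover have "A h = M t -` {k. coord_sum k = h \<and> h \<in> S} \<inter> space P" for h
    by (auto simp: A_def)
  ultimately have "A h \<in> events" for h
    by simp
  then have "(\<lambda>h. prob (A h)) sums prob (\<Union>h. A h)"
    by (intro finite_measure_UNION) (auto simp: disjoint_family_on_def A_def)
  moreover have "(\<Union>h. A h) = {w \<in> space P. coord_sum (M t w) \<in> S}"
    by (auto simp: A_def)
  moreover have "prob (A h) = (if h \<in> S then ml_term (coord_sum lam powr (1 / \<nu>)) \<nu> t h
      / mittag_leffler \<nu> 1 (coord_sum lam * t powr \<nu>) else 0)" for h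
    using prob_coord_sum[OF assms, of h] by (simp add: A_def)
  ultimately show ?thesis
    by simp
qed

section \<open>Bounds on sums of Mittag-Leffler terms\<close>

lemma ml_term_le_exp_poisson_rate:
  assumes "0 < c" "0 < \<nu>" "0 < t"
  shows "ml_term c \<nu> t h \<le> exp (c * t - t * poisson_rate c (\<nu> * (real h / t)))"
  using powr_div_Gamma_le[of "c * t" "\<nu> * real h"] poisson_rate_scale[of c t "\<nu> * (real h / t)"] assms
  by (simp add: ml_term_def)

lemma ml_term_ge_exp_poisson_rate:
  assumes "0 < c" "0 < \<nu>" "0 < t"
  shows "exp (c * t - t * poisson_rate c (\<nu> * (real h / t))) / (exp 1 * (\<nu> * real h + 1)) \<le> ml_term c \<nu> t h"
  using powr_div_Gamma_ge[of "c * t" "\<nu> * real h"] poisson_rate_scale[of c t "\<nu> * (real h / t)"] assms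
  by (simp add: ml_term_def)

text \<open>Each term is at most \<open>exp (c t - t H)\<close> with \<open>H = poisson_rate c (\<nu> h / t)\<close>. Out of the exponent \<open>t H\<close>,
  the part \<open>(t - 1) H\<close> is bounded below by \<open>(t - 1) L\<close>, while the remaining \<open>H\<close> is bounded below by
  the tangent line, which leaves a geometric series of ratio \<open>exp (- \<nu> / t)\<close>. Its sum is of order
  \<open>t\<close>, hence invisible on the exponential scale. The bound is uniform in the set \<open>S\<close>.\<close>
lemma sum_ml_term_le:
  assumes "0 < c" "0 < \<nu>" "1 \<le> t"
    and L: "\<And>h. h \<in> S \<Longrightarrow> L \<le> poisson_rate c (\<nu> * (real h / t))"
    and Q: "(\<lambda>h. if h \<in> S then ml_term c \<nu> t h else 0) sums Q"
  shows "Q \<le> exp (c * t - (t - 1) * L + (exp 1 - 1) * c) * (1 + t / \<nu>)"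
proof -
  define B where "B = exp (c * t - (t - 1) * L + (exp 1 - 1) * c)"
  define q where "q = exp (- (\<nu> / t))"
  have q: "0 < q" "q < 1"
    using assms by (auto simp: q_def)
  have geometric: "(\<lambda>h. B * q ^ h) sums (B * (1 / (1 - q)))"
    using q by (intro sums_mult geometric_sums) auto
  have "(if h \<in> S then ml_term c \<nu> t h else 0) \<le> B * q ^ h" for h
  proof (cases "h \<in> S")
    case True
    define H where "H = poisson_rate c (\<nu> * (real h / t))"
    have "(t - 1) * L \<le> (t - 1) * H"
      using L[OF True] assms by (intro mult_left_mono) (auto simp: H_def)
    moreover have "\<nu> * (real h / t) - (exp 1 - 1) * c \<le> H"
      unfolding H_def using assms by (intro poisson_rate_ge_linear) auto
    ultimately have "c * t - t * H \<le> (c * t - (t - 1) * L + (exp 1 - 1) * c) + real h * (- (\<nu> / t))"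
      by (simp add: algebra_simps)
    then have "exp (c * t - t * H) \<le> B * q ^ h"
      unfolding B_def q_def exp_of_nat_mult[symmetric] exp_add[symmetric] by simp
    then show ?thesis
      using ml_term_le_exp_poisson_rate[of c \<nu> t h] assms True by (simp add: H_def)
  qed (use q in \<open>simp add: B_def\<close>)
  then have "Q \<le> B * (1 / (1 - q))"
    using Q geometric by (rule sums_le)
  also have "1 / (1 - q) \<le> 1 + t / \<nu>"
  proof -
    have "1 + \<nu> / t \<le> exp (\<nu> / t)"
      by (rule exp_ge_add_one_self)
    then have "q * (1 + \<nu> / t) \<le> q * exp (\<nu> / t)"
      using q by (intro mult_left_mono) auto
    also have "q * exp (\<nu> / t) = 1"
      by (simp add: q_def flip: exp_add)
    finally have "q * (t + \<nu>) \<le> t"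
      using assms by (simp add: field_simps)
    then show ?thesis
      using assms q by (simp add: field_simps)
  qed
  finally show ?thesis
    by (simp add: B_def)
qed

text \<open>A single term suffices: for the largest \<open>h\<close> with \<open>\<nu> h \<le> c t\<close>, the point \<open>\<nu> h\<close> is within distance
  \<open>\<nu> \<le> 1\<close> of the zero \<open>u = c t\<close> of \<open>poisson_rate u\<close>, so the rate there is at most 1.\<close>
lemma sum_ml_term_ge:
  assumes "1 \<le> c" "0 < \<nu>" "\<nu> \<le> 1" "1 \<le> t"
    and Q: "(ml_term c \<nu> t) sums Q"
  shows "exp (c * t) \<le> Q * (exp 2 * (c * t + 1))"
proof -
  define u where "u = c * t"
  define h where "h = nat \<lfloor>u / \<nu>\<rfloor>"
  define z where "z = \<nu> * real h"
  have u: "1 \<le> u"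
    using mult_mono[of 1 c 1 t] assms by (simp add: u_def)
  have h: "real h \<le> u / \<nu>" "u / \<nu> < real h + 1"
    using u assms by (auto simp: h_def)
  have z: "0 \<le> z" "z \<le> u" "u - 1 \<le> z"
  proof -
    show "z \<le> u"
      using h assms by (simp add: z_def field_simps)
    have "u < z + \<nu>"
      using h assms by (simp add: z_def field_simps)
    then show "u - 1 \<le> z"
      using assms by simp
  qed (use assms in \<open>simp add: z_def\<close>)
  \<comment> \<open>The logarithm is replaced by its tangent, so that the rate is at most the chi-squared
    distance \<open>(u - z)\<^sup>2 / u\<close>.\<close>
  have "poisson_rate u z \<le> 1"
  proof (cases "z = 0")
    case False
    have "ln (z / u) \<le> z / u - 1"
      using False z u by (intro ln_le_minus_one) auto
    then have "z * ln (z / u) \<le> z * (z / u - 1)"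
      using z by (intro mult_left_mono) auto
    then have "poisson_rate u z \<le> (u - z) ^ 2 / u"
      using u by (simp add: poisson_rate_def power2_eq_square field_simps)
    also have "\<dots> \<le> 1 ^ 2 / 1"
      using u z by (intro frac_le power_mono) auto
    finally show ?thesis by simp
  qed (use z in \<open>simp add: poisson_rate_def\<close>)
  then have "exp u \<le> exp (u - poisson_rate u z) * exp 1"
    by (simp flip: exp_add)
  also have "\<dots> = exp (u - poisson_rate u z) / (exp 1 * (z + 1)) * (exp 2 * (z + 1))"
    using z exp_add[of 1 "1 :: real"] by simp
  also have "\<dots> \<le> ml_term c \<nu> t h * (exp 2 * (u + 1))"
    using powr_div_Gamma_ge[of u z] z u ml_term_nonneg[of \<nu> c t h] assms(2)
    by (intro mult_mono) (auto simp: ml_term_def z_def u_def)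
  also have "ml_term c \<nu> t h \<le> Q"
    using sum_le_suminf[OF sums_summable[OF Q], of "{h}"] sums_unique[OF Q] ml_term_nonneg assms(2)
    by simp
  finally show ?thesis
    using u by (simp add: u_def)
qed

section \<open>Probabilities of events on the coordinate sum\<close>

text \<open>Countable additivity shows that the normalised terms sum to 1. This is where the convergence of the
  Mittag-Leffler series comes from; its value is positive because \<open>exp (c t)\<close> is at most a
  positive multiple of it.\<close>
lemma mittag_leffler_normalises:
  fixes lam :: "real ^ 'm"
  assumes "prob_space P" "0 < \<nu>" "\<nu> \<le> 1" "1 \<le> coord_sum lam" "alt_frac_poisson P \<nu> lam M" "1 \<le> t"
  defines "c \<equiv> coord_sum lam powr (1 / \<nu>)" and "E \<equiv> mittag_leffler \<nu> 1 (coord_sum lam * t powr \<nu>)"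
  shows "(ml_term c \<nu> t) sums E" and "0 < E" 
    and "(\<lambda>h. if h \<in> S then ml_term c \<nu> t h else 0) sums (measure P {w \<in> space P. coord_sum (M t w) \<in> S} * E)"
proof -
  interpret prob_space P by fact
  have c: "1 \<le> c"
    unfolding c_def using assms by (intro ge_one_powr_ge_zero) auto
  have law: "(\<lambda>h. if h \<in> S then ml_term c \<nu> t h / E else 0)
      sums prob {w \<in> space P. coord_sum (M t w) \<in> S}" for S
    using prob_coord_sum_in[of P \<nu> lam M t S] assms(1-6) unfolding c_def E_def by simp
  have "(\<lambda>h. ml_term c \<nu> t h / E) sums 1"
    using law[of UNIV] prob_space by simp
  moreover from this have E0: "E \<noteq> 0"
    using sums_unique2[of "\<lambda>_. 0" 0 "1 :: real"] by auto
  ultimately show total: "(ml_term c \<nu> t) sums E"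
    using sums_mult[of "\<lambda>h. ml_term c \<nu> t h / E" 1 E] by simp
  have "0 < E * (exp 2 * (c * t + 1))"
    using sum_ml_term_ge[OF c assms(2,3,6) total] by (rule less_le_trans[OF exp_gt_zero])
  moreover have "0 < exp 2 * (c * t + 1)"
    using c assms(6) by (intro mult_pos_pos add_nonneg_pos) auto
  ultimately show "0 < E"
    by (rule zero_less_mult_pos2)
  show "(\<lambda>h. if h \<in> S then ml_term c \<nu> t h else 0) sums (prob {w \<in> space P. coord_sum (M t w) \<in> S} * E)"
    using sums_mult2[OF law[of S], of E] E0 by (simp add: if_distrib[of "\<lambda>x. x * E"] cong: if_cong)
qed

text \<open>The factor \<open>exp (c t)\<close> of the numerator cancels against the lower bound for the normalising
  series; only a factor of quadratic growth in \<open>t\<close> is left in front of \<open>exp (- t L)\<close>.\<close>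
lemma prob_coord_sum_in_le:
  fixes lam :: "real ^ 'm"
  assumes "prob_space P" "0 < \<nu>" "\<nu> \<le> 1" "1 \<le> coord_sum lam" "alt_frac_poisson P \<nu> lam M" "1 \<le> t"
  defines "c \<equiv> coord_sum lam powr (1 / \<nu>)"
  assumes L: "\<And>h. h \<in> S \<Longrightarrow> L \<le> poisson_rate c (\<nu> * (real h / t))"
  shows "measure P {w \<in> space P. coord_sum (M t w) \<in> S} \<le>
    exp (L + (exp 1 - 1) * c + 2) * (1 + t / \<nu>) * (c * t + 1) * exp (- t * L)"
proof -
  define E where "E = mittag_leffler \<nu> 1 (coord_sum lam * t powr \<nu>)"
  define p where "p = measure P {w \<in> space P. coord_sum (M t w) \<in> S}"
  have c: "1 \<le> c"
    unfolding c_def using assms by (intro ge_one_powr_ge_zero) auto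
  note norm = mittag_leffler_normalises[OF assms(1-6), folded c_def E_def]
  have "p * E \<le> exp (c * t - (t - 1) * L + (exp 1 - 1) * c) * (1 + t / \<nu>)"
    using sum_ml_term_le[OF _ assms(2,6) L norm(3)] c unfolding p_def by simp
  also have "\<dots> = exp (L + (exp 1 - 1) * c) * (1 + t / \<nu>) * exp (- t * L) * exp (c * t)"
    by (simp add: algebra_simps flip: exp_add)
  also have "\<dots> \<le> exp (L + (exp 1 - 1) * c) * (1 + t / \<nu>) * exp (- t * L) * (E * (exp 2 * (c * t + 1)))"
    using sum_ml_term_ge[OF c assms(2,3,6) norm(1)] assms(2,6) by (intro mult_left_mono) auto
  also have "\<dots> = exp (L + (exp 1 - 1) * c + 2) * (1 + t / \<nu>) * (c * t + 1) * exp (- t * L) * E"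
    unfolding exp_add[of _ 2] by (simp only: mult_ac)
  finally show ?thesis
    using norm(2) unfolding p_def by (rule mult_right_le_imp_le)
qed

text \<open>The point mass at \<open>h\<close> is compared with an upper bound for the normalising series, namely the
  summation bound for the full lattice with \<open>L = 0\<close>.\<close>
lemma prob_coord_sum_in_ge:
  fixes lam :: "real ^ 'm"
  assumes "prob_space P" "0 < \<nu>" "\<nu> \<le> 1" "1 \<le> coord_sum lam" "alt_frac_poisson P \<nu> lam M" "1 \<le> t"
  defines "c \<equiv> coord_sum lam powr (1 / \<nu>)"
  assumes h: "h \<in> S"
  shows "exp (- t * poisson_rate c (\<nu> * (real h / t))) /
      (exp 1 * (\<nu> * real h + 1) * exp ((exp 1 - 1) * c) * (1 + t / \<nu>))
    \<le> measure P {w \<in> space P. coord_sum (M t w) \<in> S}"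
proof -
  define E where "E = mittag_leffler \<nu> 1 (coord_sum lam * t powr \<nu>)"
  define p where "p = measure P {w \<in> space P. coord_sum (M t w) \<in> S}"
  define x where "x = exp (- t * poisson_rate c (\<nu> * (real h / t)))"
  define A where "A = exp 1 * (\<nu> * real h + 1)"
  define B where "B = exp ((exp 1 - 1) * c) * (1 + t / \<nu>)"
  have A: "0 < A" and B: "0 < B"
    unfolding A_def B_def using assms(2,6)
    by (intro mult_pos_pos add_nonneg_pos add_pos_nonneg mult_nonneg_nonneg; simp)+
  have c: "1 \<le> c"
    unfolding c_def using assms by (intro ge_one_powr_ge_zero) auto
  note norm = mittag_leffler_normalises[OF assms(1-6), folded c_def E_def]
  have "(\<lambda>h. if h \<in> UNIV then ml_term c \<nu> t h else 0) sums E"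
    using norm(1) by simp
  from sum_ml_term_le[OF _ assms(2,6) _ this, of 0] have "E \<le> exp (c * t + (exp 1 - 1) * c) * (1 + t / \<nu>)"
    using c assms(2,6) poisson_rate_nonneg by simp
  then have E: "E \<le> exp (c * t) * B"
    by (simp add: B_def exp_add)
  have "exp (c * t) * x / A = exp (c * t - t * poisson_rate c (\<nu> * (real h / t))) / A"
    by (simp add: x_def flip: exp_add)
  also have "\<dots> \<le> ml_term c \<nu> t h"
    unfolding A_def using ml_term_ge_exp_poisson_rate c assms(2,6) by simp
  also have "\<dots> \<le> p * E"
    using sum_le_suminf[OF sums_summable[OF norm(3)[of S]], of "{h}"] sums_unique[OF norm(3)[of S]]
      ml_term_nonneg[OF assms(2)] h by (simp add: p_def)
  also have "\<dots> \<le> p * (exp (c * t) * B)"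
    using E by (intro mult_left_mono) (auto simp: p_def)
  also have "\<dots> = exp (c * t) * (p * B)"
    by (rule mult.left_commute)
  finally have "exp (c * t) * (x / A) \<le> exp (c * t) * (p * B)"
    by (simp only: times_divide_eq_right)
  then have "x / A \<le> p * B"
    by (rule mult_left_le_imp_le) simp
  then have "x / (A * B) \<le> p"
    using A B by (simp add: field_simps)
  then show ?thesis
    by (simp add: x_def A_def B_def p_def mult_ac)
qed

section \<open>Passing to the exponential scale\<close>

lemma Limsup_elog_le:
  assumes B: "\<And>t. 1 \<le> t \<Longrightarrow> 0 < B t" and sub: "((\<lambda>t. ln (B t) / t) \<longlongrightarrow> 0) at_top"
    and p: "\<And>t. 1 \<le> t \<Longrightarrow> p t \<le> B t * exp (- t * L)"
  shows "Limsup at_top (\<lambda>t. ereal (1 / t) * elog (p t)) \<le> ereal (- L)"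
proof -
  have "Limsup at_top (\<lambda>t. ereal (1 / t) * elog (p t)) \<le> Limsup at_top (\<lambda>t. ereal (ln (B t) / t - L))"
  proof (rule Limsup_mono)
    show "\<forall>\<^sub>F t in at_top. ereal (1 / t) * elog (p t) \<le> ereal (ln (B t) / t - L)"
      using eventually_ge_at_top[of 1]
    proof eventually_elim
      case (elim t)
      show ?case
      proof (cases "p t \<le> 0")
        case False
        then have "ln (p t) \<le> ln (B t * exp (- t * L))"
          using p[OF elim] by (intro ln_mono) auto
        also have "\<dots> = ln (B t) - t * L"
          using B[OF elim] by (simp add: ln_mult)
        finally have "1 / t * ln (p t) \<le> 1 / t * (ln (B t) - t * L)"
          using elim by (intro mult_left_mono) auto
        then show ?thesis
          using elim False by (simp add: elog_def diff_divide_distrib)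
      qed (use elim in \<open>simp add: elog_def\<close>)
    qed
  qed
  also have "((\<lambda>t. ln (B t) / t - L) \<longlongrightarrow> 0 - L) at_top"
    by (intro tendsto_intros sub)
  then have "Limsup at_top (\<lambda>t. ereal (ln (B t) / t - L)) = ereal (- L)"
    by (intro lim_imp_Limsup) auto
  finally show ?thesis .
qed

lemma Liminf_elog_ge:
  assumes D: "\<And>t. 1 \<le> t \<Longrightarrow> 0 < D t" and sub: "((\<lambda>t. ln (D t) / t) \<longlongrightarrow> 0) at_top"
    and r: "(r \<longlongrightarrow> L) at_top"
    and p: "\<forall>\<^sub>F t in at_top. exp (- t * r t) / D t \<le> p t"
  shows "ereal (- L) \<le> Liminf at_top (\<lambda>t. ereal (1 / t) * elog (p t))"
proof -
  have "((\<lambda>t. - r t - ln (D t) / t) \<longlongrightarrow> - L - 0) at_top"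
    by (intro tendsto_intros sub r)
  then have "Liminf at_top (\<lambda>t. ereal (- r t - ln (D t) / t)) = ereal (- L)"
    by (intro lim_imp_Liminf) auto
  moreover have "Liminf at_top (\<lambda>t. ereal (- r t - ln (D t) / t)) \<le> Liminf at_top (\<lambda>t. ereal (1 / t) * elog (p t))"
  proof (rule Liminf_mono)
    show "\<forall>\<^sub>F t in at_top. ereal (- r t - ln (D t) / t) \<le> ereal (1 / t) * elog (p t)"
      using p eventually_ge_at_top[of 1]
    proof eventually_elim
      case (elim t)
      have pos: "0 < exp (- t * r t) / D t"
        using D elim by simp
      have "ln (exp (- t * r t) / D t) \<le> ln (p t)"
        using pos elim(1) by (intro ln_mono) auto
      then have "1 / t * (- t * r t - ln (D t)) \<le> 1 / t * ln (p t)"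
        using D[OF elim(2)] elim by (intro mult_left_mono) (auto simp: ln_div)
      then show ?case
        using pos elim by (simp add: elog_def diff_divide_distrib)
    qed
  qed
  ultimately show ?thesis by simp
qed

section \<open>The transformation of the sample mean and the rate function\<close>

lemma f_fun_strict_antimono:
  assumes "1 \<le> a" "0 < x" "x < y"
  shows "f_fun a y < f_fun a x"
proof -
  have "1 / y < 1 / x"
    using assms by (simp add: frac_less2)
  moreover from this have "a powr (1 / y) \<le> a powr (1 / x)"
    using assms by (intro powr_mono) auto
  ultimately show ?thesis
    unfolding f_fun_def using assms by (intro mult_less_le_imp_less) auto
qed

lemma f_fun_less_iff:
  assumes "1 \<le> a" "0 < x" "0 < y"
  shows "f_fun a x < f_fun a y \<longleftrightarrow> y < x"
  using f_fun_strict_antimono assms by (metis linorder_neqE_linordered_idom order_less_asym)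

lemma f_fun_pos: "1 \<le> a \<Longrightarrow> 0 < x \<Longrightarrow> 0 < f_fun a x"
  by (simp add: f_fun_def)

lemma g_fun_pos_real:
  assumes "1 \<le> a" "0 < y"
  obtains x where "0 < x" "f_fun a x = y" "g_fun a (ereal y) = ereal x"
proof
  note bij = f_fun_bij_betw[OF assms(1)]
  define x where "x = the_inv_into {0<..} (f_fun a) y"
  show "f_fun a x = y" "0 < x"
    unfolding x_def using bij assms f_the_inv_into_f_bij_betw[OF bij, of y]
      the_inv_into_into[of "f_fun a" "{0<..}" y "{0<..}"] by (auto simp: bij_betw_def)
  show "g_fun a (ereal y) = ereal x"
    using assms by (simp add: g_fun_def x_def)
qed

text \<open>Continuity of the inverse of \<open>f_fun a\<close>: by strict monotonicity \<open>g_fun a y\<close> lies between \<open>l\<close>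
  and \<open>u\<close> as soon as \<open>y\<close> lies between \<open>f_fun a u\<close> and \<open>f_fun a l\<close>.\<close>
lemma tendsto_g_fun:
  assumes a: "1 \<le> a" and x: "0 < x" and Y: "(Y \<longlongrightarrow> f_fun a x) F"
  shows "((\<lambda>t. g_fun a (ereal (Y t))) \<longlongrightarrow> ereal x) F"
proof -
  have pos: "\<forall>\<^sub>F t in F. 0 < Y t"
    using order_tendstoD(1)[OF Y f_fun_pos[OF a x]] .
  define X where "X t = real_of_ereal (g_fun a (ereal (Y t)))" for t
  have X: "0 < X t \<and> f_fun a (X t) = Y t \<and> g_fun a (ereal (Y t)) = ereal (X t)" if "0 < Y t" for t
    by (rule g_fun_pos_real[OF a that]) (simp add: X_def)
  have "(X \<longlongrightarrow> x) F"
  proof (rule order_tendstoI)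
    fix l assume "l < x"
    \<comment> \<open>\<open>l\<close> may be nonpositive, where \<open>f_fun\<close> has no meaning; it is raised to a positive bound.\<close>
    define l' where "l' = max l (x / 2)"
    have l': "0 < l'" "l' < x"
      using x \<open>l < x\<close> by (auto simp: l'_def)
    have "\<forall>\<^sub>F t in F. Y t < f_fun a l'"
      using order_tendstoD(2)[OF Y f_fun_strict_antimono[OF a l']] .
    with pos show "\<forall>\<^sub>F t in F. l < X t"
    proof eventually_elim
      case (elim t)
      then show ?case
        using f_fun_less_iff[of a "X t" l'] X[of t] a l' by (auto simp: l'_def)
    qed
  next
    fix u assume u: "x < u"
    have "\<forall>\<^sub>F t in F. f_fun a u < Y t"
      using order_tendstoD(1)[OF Y f_fun_strict_antimono[OF a x u]] .
    with pos show "\<forall>\<^sub>F t in F. X t < u"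
    proof eventually_elim
      case (elim t)
      then show ?case
        using f_fun_less_iff[of a u "X t"] X[of t] a u x by auto
    qed
  qed
  then have "((\<lambda>t. ereal (X t)) \<longlongrightarrow> ereal x) F"
    by simp
  then show ?thesis
    by (rule Lim_transform_eventually) (use pos X in \<open>auto elim!: eventually_mono\<close>)
qed

text \<open>The two equations below identify \<open>J_rate\<close> as the contraction of the Poisson rate function under
  \<open>g_fun\<close>; the second includes the endpoint \<open>y = 0\<close>, which corresponds to the value \<open>\<infinity>\<close>.\<close>
lemma J_rate_ereal:
  assumes "0 < s" "0 < x"
  shows "J_rate \<nu> s (ereal x) = ereal (poisson_rate (s powr (1 / \<nu>)) (\<nu> * f_fun s x))"
  using assms by (simp add: J_rate_def poisson_rate_def f_fun_def Let_def powr_diff)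

lemma J_rate_g_fun:
  assumes "1 \<le> s" "0 \<le> y"
  shows "J_rate \<nu> s (g_fun s (ereal y)) = ereal (poisson_rate (s powr (1 / \<nu>)) (\<nu> * y))"
proof (cases "y = 0")
  case True
  then show ?thesis
    by (simp add: J_rate_def g_fun_def poisson_rate_def)
next
  case False
  then show ?thesis
    using assms g_fun_pos_real[of s y] J_rate_ereal[of s] by (metis order_le_less zero_less_one order_less_le_trans)
qed

text \<open>Continuity on the whole extended line reduces to the two limits at the ends of \<open>(0,\<infinity>)\<close>: as
  \<open>r \<rightarrow> 0\<close>, \<open>f_fun s r \<ge> 1 / r\<close> tends to infinity and the rate with it; as \<open>r \<rightarrow> \<infinity>\<close>,
  \<open>f_fun s r\<close> tends to 0, where the rate is \<open>c\<close>.\<close>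
lemma continuous_J_rate:
  assumes "1 \<le> s" "0 < \<nu>"
  shows "continuous_on UNIV (J_rate \<nu> s)"
proof -
  define c where "c = s powr (1 / \<nu>)"
  have c: "0 < c"
    using assms by (simp add: c_def)
  have J: "J_rate \<nu> s (ereal x) = ereal (poisson_rate c (\<nu> * f_fun s x))" if "0 < x" for x
    using J_rate_ereal that assms by (simp add: c_def)
  have J_neg: "J_rate \<nu> s y = \<infinity>" if "y < 0" for y
    using that by (auto simp: J_rate_def)
  have "(J_rate \<nu> s \<longlongrightarrow> J_rate \<nu> s x) (at x)" for x
  proof -
    consider "x < 0" | "x = 0" | r where "x = ereal r" "0 < r" | "x = \<infinity>"
      by (cases x) (auto, metis less_linear)
    then show ?thesis
    proof cases
      case 1
      have "\<forall>\<^sub>F y in at x. y < 0"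
        using 1 by (rule order_tendstoD(2)[OF tendsto_ident_at])
      then show ?thesis
        using 1 by (intro tendsto_eventually) (auto simp: J_rate_def elim!: eventually_mono)
    next
      case 2
      have "(J_rate \<nu> s \<longlongrightarrow> \<infinity>) (at_left 0)"
        using 2 by (intro tendsto_eventually) (simp add: J_neg eventually_at_filter)
      moreover have "(J_rate \<nu> s \<longlongrightarrow> \<infinity>) (at_right 0)"
      proof -
        have "filterlim (\<lambda>p. poisson_rate c p) at_top at_top"
          unfolding poisson_rate_def using c by real_asymp
        moreover have "filterlim (\<lambda>r. \<nu> * f_fun s r) at_top (at_right 0)"
        proof (rule filterlim_at_top_mono)
          show "filterlim (\<lambda>r. \<nu> * (1 / r)) at_top (at_right 0)"
            using assms by real_asymp
          have "\<nu> * (1 / r) \<le> \<nu> * f_fun s r" if "0 < r" for r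
            using assms that ge_one_powr_ge_zero[of s "1 / r"]
            by (auto simp: f_fun_def divide_right_mono)
          then show "\<forall>\<^sub>F r in at_right 0. \<nu> * (1 / r) \<le> \<nu> * f_fun s r"
            by (auto simp: eventually_at_filter)
        qed
        ultimately have "filterlim (\<lambda>r. poisson_rate c (\<nu> * f_fun s r)) at_top (at_right 0)"
          by (rule filterlim_compose)
        then have "((\<lambda>r. ereal (poisson_rate c (\<nu> * f_fun s r))) \<longlongrightarrow> \<infinity>) (at_right 0)"
          by (simp add: tendsto_PInfty_eq_at_top)
        then have "((\<lambda>r. J_rate \<nu> s (ereal r)) \<longlongrightarrow> \<infinity>) (at_right 0)"
          by (rule Lim_transform_eventually) (auto simp: J eventually_at_filter)
        then show ?thesis
          by (simp add: zero_ereal_def at_right_ereal filterlim_filtermap)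
      qed
      ultimately show ?thesis
        using 2 by (simp add: filterlim_split_at J_rate_def)
    next
      case 3
      have "((\<lambda>q. poisson_rate c (\<nu> * f_fun s q)) \<longlongrightarrow> poisson_rate c (\<nu> * f_fun s r)) (at r)"
        unfolding poisson_rate_def f_fun_def using 3 c assms by (intro tendsto_intros) auto
      then have "((\<lambda>q. ereal (poisson_rate c (\<nu> * f_fun s q))) \<longlongrightarrow> J_rate \<nu> s (ereal r)) (at r)"
        using 3 J by simp
      moreover have "\<forall>\<^sub>F q in at r. 0 < q"
        using 3(2) by (rule order_tendstoD(1)[OF tendsto_ident_at])
      then have "\<forall>\<^sub>F q in at r. ereal (poisson_rate c (\<nu> * f_fun s q)) = J_rate \<nu> s (ereal q)"
        by eventually_elim (simp add: J)
      ultimately have "((\<lambda>q. J_rate \<nu> s (ereal q)) \<longlongrightarrow> J_rate \<nu> s (ereal r)) (at r)"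
        by (rule Lim_transform_eventually)
      then show ?thesis
        using 3 by (simp add: at_ereal filterlim_filtermap)
    next
      case 4
      have "((\<lambda>p. poisson_rate c p) \<longlongrightarrow> c) (at_right 0)"
        unfolding poisson_rate_def using c by real_asymp
      moreover have "filterlim (\<lambda>r. \<nu> * f_fun s r) (at_right 0) at_top"
      proof -
        have inv: "((\<lambda>r :: real. 1 / r) \<longlongrightarrow> 0) at_top"
          by real_asymp
        have "((\<lambda>r. \<nu> * (1 / r * s powr (1 / r))) \<longlongrightarrow> \<nu> * (0 * s powr 0)) at_top"
          using assms by (intro tendsto_intros inv) auto
        then show ?thesis
          using assms by (intro tendsto_imp_filterlim_at_right)
            (auto simp: f_fun_def intro!: eventually_mono[OF eventually_gt_at_top[of 0]])
      qed
      ultimately have "((\<lambda>r. poisson_rate c (\<nu> * f_fun s r)) \<longlongrightarrow> c) at_top"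
        by (rule filterlim_compose)
      then have "((\<lambda>r. ereal (poisson_rate c (\<nu> * f_fun s r))) \<longlongrightarrow> J_rate \<nu> s \<infinity>) at_top"
        by (simp add: J_rate_def c_def)
      then have "((\<lambda>r. J_rate \<nu> s (ereal r)) \<longlongrightarrow> J_rate \<nu> s \<infinity>) at_top"
        by (rule Lim_transform_eventually) (auto simp: J intro!: eventually_mono[OF eventually_gt_at_top[of 0]])
      moreover have "at (\<infinity> :: ereal) = filtermap ereal at_top"
        by (simp add: at_left_PInf[symmetric] at_eq_sup_left_right trivial_limit_at_right_top flip: top_ereal_def)
      ultimately show ?thesis
        using 4 by (simp add: filterlim_filtermap)
    qed
  qed
  then show ?thesis
    by (simp add: continuous_on_def)
qed

lemma J_rate_nonneg:
  assumes "1 \<le> s" "0 < \<nu>"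
  shows "0 \<le> J_rate \<nu> s x"
proof (cases "0 < x \<and> x < \<infinity>")
  case True
  then obtain r where "x = ereal r" "0 < r"
    by (cases x) auto
  then show ?thesis
    using assms poisson_rate_nonneg[of "s powr (1 / \<nu>)" "\<nu> * f_fun s r"] f_fun_pos[of s r]
    by (simp add: J_rate_ereal)
qed (auto simp: J_rate_def not_less)

text \<open>Closed subsets of the extended line are compact, and the level sets avoid \<open>- \<infinity>\<close> because the
  rate is infinite there.\<close>
lemma good_rate_function_J_rate:
  assumes "1 \<le> s" "0 < \<nu>"
  shows "good_rate_function (top_of_set {-\<infinity><..}) (J_rate \<nu> s)"
  unfolding good_rate_function_def rate_function_def
proof (intro conjI allI impI ballI)
  note cont = continuous_J_rate[OF assms]
  show "0 \<le> J_rate \<nu> s z" for z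
    using assms by (rule J_rate_nonneg)
  have "open {z. k < J_rate \<nu> s z}" for k
    using cont by (intro open_Collect_less continuous_on_const)
  then show "openin (top_of_set {-\<infinity><..}) {z \<in> topspace (top_of_set {-\<infinity><..}). k < J_rate \<nu> s z}" for k
    by (auto simp: openin_open)
  fix \<gamma> :: real
  have "closed {z. J_rate \<nu> s z \<le> ereal \<gamma>}"
    using cont by (intro closed_Collect_le continuous_on_const)
  then have "compact {z. J_rate \<nu> s z \<le> ereal \<gamma>}"
    by (simp only: compact_eq_closed)
  moreover have "J_rate \<nu> s (-\<infinity>) = \<infinity>"
    by (simp add: J_rate_def)
  then have sub: "{z. J_rate \<nu> s z \<le> ereal \<gamma>} \<subseteq> {-\<infinity><..}"
    by auto
  moreover from sub have "{z \<in> topspace (top_of_set {-\<infinity><..}). J_rate \<nu> s z \<le> ereal \<gamma>} =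
      {z. J_rate \<nu> s z \<le> ereal \<gamma>}"
    by auto
  ultimately show "compactin (top_of_set {-\<infinity><..})
      {z \<in> topspace (top_of_set {-\<infinity><..}). J_rate \<nu> s z \<le> ereal \<gamma>}"
    by (simp only: compactin_subtopology compactin_euclidean_iff)
qed

lemma tendsto_nat_floor_divide:
  assumes "0 \<le> y"
  shows "((\<lambda>t. real (nat \<lfloor>y * t\<rfloor>) / t) \<longlongrightarrow> y) at_top"
proof (rule tendsto_sandwich)
  show "((\<lambda>t. y - 1 / t) \<longlongrightarrow> y) at_top" by real_asymp
  show "((\<lambda>_. y) \<longlongrightarrow> y) at_top" by simp
  have bounds: "y - 1 / t \<le> real (nat \<lfloor>y * t\<rfloor>) / t \<and> real (nat \<lfloor>y * t\<rfloor>) / t \<le> y" if "0 < t" for t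
  proof -
    have "real (nat \<lfloor>y * t\<rfloor>) = \<lfloor>y * t\<rfloor>"
      using assms that by simp
    then have "y * t - 1 \<le> real (nat \<lfloor>y * t\<rfloor>)" "real (nat \<lfloor>y * t\<rfloor>) \<le> y * t"
      by linarith+
    then have "(y * t - 1) / t \<le> real (nat \<lfloor>y * t\<rfloor>) / t" "real (nat \<lfloor>y * t\<rfloor>) / t \<le> y * t / t"
      using that by (intro divide_right_mono; simp)+
    then show ?thesis
      using that by (simp add: diff_divide_distrib)
  qed
  show "\<forall>\<^sub>F t in at_top. y - 1 / t \<le> real (nat \<lfloor>y * t\<rfloor>) / t"
    using eventually_gt_at_top[of 0] by eventually_elim (use bounds in blast)
  show "\<forall>\<^sub>F t in at_top. real (nat \<lfloor>y * t\<rfloor>) / t \<le> y"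
    using eventually_gt_at_top[of 0] by eventually_elim (use bounds in blast)
qed

theorem proposition3:
  fixes P :: "'w measure" and \<nu> :: real and lam :: "real ^ 'm"
    and M :: "real \<Rightarrow> 'w \<Rightarrow> nat ^ 'm"
  assumes "prob_space P"
    and "0 < \<nu>" and "\<nu> \<le> 1"
    and "\<forall>i. 0 < lam $ i"
    and "1 \<le> coord_sum lam"
    and "alt_frac_poisson P \<nu> lam M"
  shows "good_rate_function (top_of_set {-\<infinity><..}) (J_rate \<nu> (coord_sum lam)) \<and>
    satisfies_LDP P (top_of_set {-\<infinity><..})
      (\<lambda>t w. g_fun (coord_sum lam) (ereal (real (coord_sum (M t w)) / t)))
      (\<lambda>t. t) (J_rate \<nu> (coord_sum lam))"
proof -
  define s where "s = coord_sum lam"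
  define c where "c = s powr (1 / \<nu>)"
  define Z where "Z = top_of_set {-\<infinity> :: ereal<..}"
  define V where "V t w = g_fun s (ereal (real (coord_sum (M t w)) / t))" for t w
  define S where "S A t = {h. g_fun s (ereal (real h / t)) \<in> A}" for A t
  have s: "1 \<le> s"
    using assms by (simp add: s_def)
  then have c: "0 < c"
    by (simp add: c_def)
  note J_g = J_rate_g_fun[OF s, of _ \<nu>, folded c_def]
  note upper = prob_coord_sum_in_le[OF assms(1-3,5,6), folded s_def, folded c_def]
  note lower = prob_coord_sum_in_ge[OF assms(1-3,5,6), folded s_def, folded c_def]
  have V_in: "V t w \<in> A \<longleftrightarrow> coord_sum (M t w) \<in> S A t" for t w A
    by (simp add: V_def S_def)
  have good: "good_rate_function Z (J_rate \<nu> s)"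
    unfolding Z_def using s assms(2) by (rule good_rate_function_J_rate)
  have measurable: "V t \<in> measurable P (borel_measure_of Z)" if "0 < t" for t
  proof -
    have "M t \<in> measurable P (count_space UNIV)"
      using assms(6) that by (simp add: alt_frac_poisson_def)
    moreover have "(\<lambda>k. g_fun s (ereal (real (coord_sum k) / t)))
        \<in> measurable (count_space (UNIV :: (nat ^ 'm) set)) (borel_measure_of Z)"
      using that by (auto simp: borel_measure_of_def space_measure_of_conv Z_def g_fun_def)
    ultimately show ?thesis
      unfolding V_def by (rule measurable_compose)
  qed
  \<comment> \<open>The uniform summation bound gives the upper estimate for arbitrary sets \<open>A\<close>.\<close>
  have LDP_upper: "Limsup at_top (\<lambda>t. ereal (1 / t) * elog (measure P {w \<in> space P. V t w \<in> A}))
      \<le> - (INF z\<in>A. J_rate \<nu> s z)" (is "?lim \<le> - ?I") for A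
  proof -
    have bound: "?lim \<le> ereal (- L)" if L: "ereal L \<le> ?I" for L
    proof (rule Limsup_elog_le)
      let ?B = "\<lambda>t. exp (L + (exp 1 - 1) * c + 2) * (1 + t / \<nu>) * (c * t + 1)"
      show "0 < ?B t" if "1 \<le> t" for t
        using that c assms(2) by (intro mult_pos_pos add_pos_nonneg add_nonneg_pos) auto
      show "((\<lambda>t. ln (?B t) / t) \<longlongrightarrow> 0) at_top"
        using c assms(2) by real_asymp

      show "measure P {w \<in> space P. V t w \<in> A} \<le> ?B t * exp (- t * L)" if t: "1 \<le> t" for t
        unfolding V_in
      proof (rule upper[OF t])
        fix h assume "h \<in> S A t"
        then have "ereal L \<le> J_rate \<nu> s (g_fun s (ereal (real h / t)))"
          using L by (auto simp: S_def intro: order_trans INF_lower)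
        then show "L \<le> poisson_rate c (\<nu> * (real h / t))"
          using t by (simp add: J_g)
      qed
    qed
    \<comment> \<open>The infimum may be infinite, so it is approached through its real lower bounds.\<close>
    show ?thesis
    proof (rule ereal_le_real)
      fix z :: real
      assume "- ?I \<le> ereal z"
      then have "ereal (- z) \<le> ?I"
        using ereal_uminus_le_reorder[of ?I "ereal z"] by simp
      from bound[OF this] show "?lim \<le> ereal z"
        by simp
    qed
  qed
  \<comment> \<open>For a point \<open>z = g_fun s y\<close> of the open set, the single atom at the integer just below
    \<open>y t\<close> carries enough mass.\<close>
  have LDP_lower: "- (INF z\<in>G. J_rate \<nu> s z) \<le>
      Liminf at_top (\<lambda>t. ereal (1 / t) * elog (measure P {w \<in> space P. V t w \<in> G}))" (is "_ \<le> ?lim")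
    if G: "openin Z G" for G
  proof -
    have at_speed: "- ereal (poisson_rate c (\<nu> * y)) \<le> ?lim"
      if y: "0 \<le> y" and ev: "\<forall>\<^sub>F t in at_top. nat \<lfloor>y * t\<rfloor> \<in> S G t" for y
    proof -
      define h where "h t = nat \<lfloor>y * t\<rfloor>" for t
      let ?D = "\<lambda>t. exp 1 * (\<nu> * (y * t) + 1) * exp ((exp 1 - 1) * c) * (1 + t / \<nu>)"
      have "ereal (- poisson_rate c (\<nu> * y)) \<le> ?lim"
      proof (rule Liminf_elog_ge)
        show D: "0 < ?D t" if "1 \<le> t" for t
          using that y assms(2) by (intro mult_pos_pos add_pos_nonneg add_nonneg_pos) auto
        show "((\<lambda>t. ln (?D t) / t) \<longlongrightarrow> 0) at_top"
        proof (cases "y = 0")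
          case True
          then show ?thesis
            using assms(2) by simp real_asymp
        next
          case False
          then have "0 < y" using y by simp
          then show ?thesis
            using assms(2) by real_asymp
        qed
        show "((\<lambda>t. poisson_rate c (\<nu> * (real (h t) / t))) \<longlongrightarrow> poisson_rate c (\<nu> * y)) at_top"
        proof (cases "y = 0")
          case False
          then show ?thesis
            unfolding poisson_rate_def h_def using c y assms(2)
            by (intro tendsto_intros tendsto_nat_floor_divide) auto
        qed (simp add: h_def)
        show "\<forall>\<^sub>F t in at_top. exp (- t * poisson_rate c (\<nu> * (real (h t) / t))) / ?D t
            \<le> measure P {w \<in> space P. V t w \<in> G}"
          using ev eventually_ge_at_top[of 1]
        proof eventually_elim
          case (elim t)
          have "real (h t) \<le> y * t"
            using y elim unfolding h_def by (intro of_nat_floor) auto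
          then have "exp 1 * (\<nu> * real (h t) + 1) * exp ((exp 1 - 1) * c) * (1 + t / \<nu>) \<le> ?D t"
            using assms(2) elim by (intro mult_right_mono mult_left_mono add_right_mono) auto
          moreover have "0 < exp 1 * (\<nu> * real (h t) + 1) * exp ((exp 1 - 1) * c) * (1 + t / \<nu>)"
            using assms(2) elim by (intro mult_pos_pos add_pos_nonneg add_nonneg_pos) auto
          ultimately have "exp (- t * poisson_rate c (\<nu> * (real (h t) / t))) / ?D t
            \<le> exp (- t * poisson_rate c (\<nu> * (real (h t) / t))) /
              (exp 1 * (\<nu> * real (h t) + 1) * exp ((exp 1 - 1) * c) * (1 + t / \<nu>))"
            using D[OF elim(2)] by (intro divide_left_mono mult_pos_pos[OF D[OF elim(2)]]) auto
          also have "\<dots> \<le> measure P {w \<in> space P. V t w \<in> G}"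
            unfolding V_in using elim by (intro lower) (auto simp: h_def)
          finally show ?case .
        qed
      qed
      then show ?thesis by simp
    qed
    obtain T where T: "open T" "G = {-\<infinity><..} \<inter> T"
      using G by (auto simp: Z_def openin_open)
    have "- J_rate \<nu> s z \<le> ?lim" if z: "z \<in> G" for z
    proof -
      consider "z \<le> 0" | x where "z = ereal x" "0 < x" | "z = \<infinity>"
        by (cases z) (auto, metis not_le)
      then show ?thesis
      proof cases
        case 1
        then show ?thesis by (simp add: J_rate_def)
      next
        case 2
        define y where "y = f_fun s x"
        have y: "0 < y"
          using f_fun_pos s 2 by (simp add: y_def)
        have "((\<lambda>t. g_fun s (ereal (real (nat \<lfloor>y * t\<rfloor>) / t))) \<longlongrightarrow> z) at_top"
          unfolding 2 using tendsto_nat_floor_divide[of y] y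
          by (intro tendsto_g_fun[OF s 2(2)]) (auto simp: y_def)
        moreover have "open G"
          using T by auto
        ultimately have "\<forall>\<^sub>F t in at_top. nat \<lfloor>y * t\<rfloor> \<in> S G t"
          unfolding S_def mem_Collect_eq using z by (rule topological_tendstoD)
        then show ?thesis
          using at_speed[of y] y J_rate_ereal[of s x \<nu>] 2 s by (simp add: c_def y_def)
      next
        case 3
        \<comment> \<open>The value \<open>\<infinity>\<close> is taken on the event that the process sits at the origin.\<close>
        then have "0 \<in> S G t" for t
          using z by (simp add: S_def g_fun_def)
        then show ?thesis
          using at_speed[of 0] 3 by (simp add: J_rate_def poisson_rate_def c_def)
      qed
    qed
    then have "- ?lim \<le> (INF z\<in>G. J_rate \<nu> s z)"
      by (intro INF_greatest) (simp add: ereal_uminus_le_reorder)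
    then show ?thesis
      by (simp add: ereal_uminus_le_reorder)
  qed
  have hausdorff: "Hausdorff_space Z"
    unfolding Z_def
    by (intro Hausdorff_space_subtopology) (simp add: Hausdorff_space_def disjnt_def, metis hausdorff)
  have rate: "rate_function Z (J_rate \<nu> s)"
    using good by (simp add: good_rate_function_def)
  have "satisfies_LDP P Z V (\<lambda>t. t) (J_rate \<nu> s)"
    unfolding satisfies_LDP_def
    by (intro conjI allI impI assms(1) hausdorff rate filterlim_ident measurable LDP_upper LDP_lower)
  with good show ?thesis
    unfolding V_def Z_def s_def by blast
qed

end
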